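(* Let $\lambda,t\in\mathbb{R}$ with $t>0$, let $T_{\lambda,t}$ be the isosceles triangle with vertices $it,-it,\lambda$ (the zeros of $f_{\lambda,t}(z)=(z-it)(z+it)(z-\lambda)$), and let $\ell$ be the length of the smallest side of $T_{\lambda,t}$. Then $$\mathrm{skew}(T_{\lambda,t})^2=1+C(\ell)\,|\mathtt{B}_\triangle|,\qquad C(\ell)=\frac{9}{\ell^2}.$$
   Context: For a triangle $T$ with vertices $a,b,c\in\mathbb{C}$, $\mathrm{skew}(T)=L(T)/\ell(T)$, where $L(T)$ and $\ell(T)$ are the lengths of the longest and the shortest side of $T$, respectively. Also $\mathtt{B}_\triangle=\left(\frac{a+b+c}{3}\right)^2-\frac{ab+ac+bc}{3}$; for $T_{\lambda,t}$ this is $\mathtt{B}_\triangle=\frac{\lambda^2-3t^2}{9}$. *)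

theory Defs
  imports Complex_Main
begin

text \<open>A triangle is given by its vertices; collinear triples are allowed.\<close>

type_synonym triangle = "complex \<times> complex \<times> complex"

definition side_lengths :: "triangle \<Rightarrow> real set" where
  "side_lengths = (\<lambda>(a, b, c). {dist a b, dist b c, dist c a})"

definition longest_side :: "triangle \<Rightarrow> real" where
  "longest_side T = Max (side_lengths T)"

definition shortest_side :: "triangle \<Rightarrow> real" where
  "shortest_side T = Min (side_lengths T)"

definition skew :: "triangle \<Rightarrow> real" where
  "skew T = longest_side T / shortest_side T"

definition B_triangle :: "triangle \<Rightarrow> complex" where
  "B_triangle = (\<lambda>(a, b, c). ((a + b + c) / 3)\<^sup>2 - (a * b + a * c + b * c) / 3)"

definition isosceles_triangle :: "real \<Rightarrow> real \<Rightarrow> triangle" where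
  "isosceles_triangle x t =
     (\<i> * complex_of_real t, - (\<i> * complex_of_real t), complex_of_real x)"

end

theory Submission
  imports Defs
begin

text \<open>
  The sides are the base \<open>2 t\<close> and two equal legs of squared length \<open>x\<^sup>2 + t\<^sup>2\<close>. With only two
  distinct lengths, the squares of the longest and the shortest side differ by
  \<open>\<bar>(x\<^sup>2 + t\<^sup>2) - 4 t\<^sup>2\<bar> = \<bar>x\<^sup>2 - 3 t\<^sup>2\<bar>\<close>, whichever of base and legs is the longer. This is
  exactly \<open>9 \<bar>B\<bar>\<close>, and dividing by the square of the shortest side gives the formula.
\<close>

lemma side_lengths_isosceles_triangle:
  assumes "t > 0"
  shows "side_lengths (isosceles_triangle x t) = {2 * t, sqrt (x\<^sup>2 + t\<^sup>2)}"
proof -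
  have "dist (\<i> * complex_of_real t) (- (\<i> * complex_of_real t)) = 2 * t"
    using assms by (simp add: dist_norm cmod_def real_sqrt_mult)
  moreover have "dist (- (\<i> * complex_of_real t)) (complex_of_real x) = sqrt (x\<^sup>2 + t\<^sup>2)"
    by (simp add: dist_norm cmod_def)
  moreover have "dist (complex_of_real x) (\<i> * complex_of_real t) = sqrt (x\<^sup>2 + t\<^sup>2)"
    by (simp add: dist_norm cmod_def)
  ultimately show ?thesis
    by (simp add: side_lengths_def isosceles_triangle_def)
qed

lemma B_triangle_isosceles_triangle:
  "B_triangle (isosceles_triangle x t) = complex_of_real ((x\<^sup>2 - 3 * t\<^sup>2) / 9)"
  by (simp add: B_triangle_def isosceles_triangle_def complex_eq_iff power2_eq_square field_simps)

lemma max_power2_diff_min_power2: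
  fixes u v :: real
  assumes "0 \<le> u" "0 \<le> v"
  shows "(max u v)\<^sup>2 - (min u v)\<^sup>2 = \<bar>v\<^sup>2 - u\<^sup>2\<bar>"
  using assms power_mono[of u v 2] power_mono[of v u 2] by (auto simp: max_def min_def)

theorem mainTheorem5:
  fixes x t l :: real
  assumes "t > 0"
    and "l = shortest_side (isosceles_triangle x t)"
  shows "(skew (isosceles_triangle x t))\<^sup>2 = 1 + 9 / l\<^sup>2 * cmod (B_triangle (isosceles_triangle x t))"
proof -
  let ?T = "isosceles_triangle x t" and ?s = "sqrt (x\<^sup>2 + t\<^sup>2)"
  have s: "?s > 0"
    using assms(1) by (simp add: add_nonneg_pos)
  have l: "l = min (2 * t) ?s" and L: "longest_side ?T = max (2 * t) ?s"
    using assms by (simp_all add: shortest_side_def longest_side_def side_lengths_isosceles_triangle)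
  have l_pos: "l > 0"
    using l s assms(1) by simp
  have "(longest_side ?T)\<^sup>2 - l\<^sup>2 = \<bar>?s\<^sup>2 - (2 * t)\<^sup>2\<bar>"
    using max_power2_diff_min_power2[of "2 * t" ?s] l L s assms(1) by simp
  also have "\<dots> = \<bar>x\<^sup>2 - 3 * t\<^sup>2\<bar>"
    by (simp add: power_mult_distrib)
  also have "\<dots> = 9 * cmod (B_triangle ?T)"
    unfolding B_triangle_isosceles_triangle norm_of_real by simp
  finally have "(longest_side ?T)\<^sup>2 = l\<^sup>2 + 9 * cmod (B_triangle ?T)"
    by simp
  then show ?thesis
    using l_pos assms(2) by (simp add: skew_def power_divide add_divide_distrib)
qed

end
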